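(* Let $T$ be a thick tree with loops with vertex set $V$ and sink $s\in V$, let $V_0=V\setminus\{s\}$, and let $(G,\oplus)$, $G\subset \mathbb{Z}_{\ge 0}^{V_0}$, be its sandpile group (the group of recurrent configurations). Then: (i) $G=\{\mathbf u\in\mathbb{Z}_{\ge 0}^{V_0} : \deg(j)>u_j\ge \deg(j)-e_{j,p(j)} \text{ for all } j\in V_0\}$. (ii) The map $\phi: G\to\prod_{j\in V_0}\mathbb{Z}/e_{j,p(j)}\mathbb{Z}$ whose $j$-th component is $$\phi(\mathbf u)_j=\sum_{i\succeq j}u_i \pmod{e_{j,p(j)}}$$ is a group isomorphism. In particular, the abstract group structure of the sandpile group does not depend on which vertex of $T$ is chosen to be the sink. (iii) The inverse map $\phi^{-1}$ may be expressed recursively as follows: for every $\mathbf v\in\prod_{j\in V_0}\mathbb{Z}/e_{j,p(j)}\mathbb{Z}$ and every $j\in V_0$, $$\phi^{-1}(\mathbf v)_j=\begin{cases} \tilde v_j, & \text{if } j \text{ is a leaf},\\ f_j\Bigl(\tilde v_j-\sum_{i\succ j}\phi^{-1}(\mathbf v)_i\Bigr), & \text{otherwise},\end{cases}$$ where $\tilde v_j\in\{0,1,\dots,e_{j,p(j)}-1\}$ is the standard representative of $v_j\in \mathbb{Z}/e_{j,p(j)}\mathbb{Z}$, and, for any $j\in V_0$, $f_j:\mathbb{Z}\to\{\deg(j)-e_{j,p(j)},\dots,\deg(j)-1\}$ is the map uniquely determined by $f_j(m)\equiv m\pmod{e_{j,p(j)}}$.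
   Context: Graphs are finite, connected, undirected, with multiple edges and loops allowed. For vertices $i,j$, $e_{i,j}$ is the number of edges with endpoint set $\{i,j\}$ (so $e_{i,i}$ is the number of loops at $i$), and $\deg(i)=\sum_{j\in V}e_{i,j}$, so each loop is counted once. A distinguished vertex $s\in V$ is called the sink; $V_0=V\setminus\{s\}$. Thick tree with loops: a graph $T$ such that the simple graph $T'$ obtained by deleting all loops and reducing all nonzero edge multiplicities to $1$ is a tree. A leaf is a vertex $i\ne s$ of degree $1$ in $T'$. For $i,j\in V$, write $i\succeq j$ if $j$ lies on the unique path in $T'$ from $i$ to $s$ (endpoints included), and $i\succ j$ if moreover $i\ne j$. For $j\in V_0$, the parent $p(j)$ is the neighbour of $j$ in $T'$ lying on the path from $j$ to $s$ (i.e. $p(j)$ is adjacent to $j$ and $j\succ p(j)$). Sandpile model: a configuration is a vector $\mathbf u\in\mathbb{Z}_{\ge0}^{V_0}$. A vertex $i\in V_0$ is stable for $\mathbf u$ if $u_i<\deg(i)$, otherwise unstable; $\mathbf u$ is stable if all vertices of $V_0$ are. Toppling an unstable vertex $i$ replaces $u_i$ by $u_i-\deg(i)+e_{i,i}$ and $u_j$ by $u_j+e_{i,j}$ for each $j\in V_0$, $j\ne i$. Repeatedly toppling unstable vertices leads, in finitely many steps, to a stable configuration that is independent of the choices, denoted $\sigma(\mathbf u)$ (the stabilization). Put $\mathbf u\oplus\mathbf v=\sigma(\mathbf u+\mathbf v)$. A configuration $\mathbf u$ is recurrent if for every configuration $\mathbf v$ there is a configuration $\mathbf w$ with $\mathbf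 v\oplus\mathbf w=\mathbf u$. The set $G$ of recurrent configurations is an abelian group under $\oplus$ (known), called the sandpile group.
   Formalization: In (iii) the first case (value equal to the standard representative) is stated only for leaves without loops; at a leaf with loops the second formula is used, since the printed leaf case contradicts (i) there (one edge to the sink plus one loop). *)

theory Defs
  imports "HOL-Algebra.Product_Groups" "HOL-Algebra.Elementary_Groups" "HOL-Number_Theory.Cong"
begin

section \<open>Multigraphs with loops\<close>

record ('a, 'b) multigraph =
  verts :: "'a set"
  edges :: "'b set"
  ends :: "'b \<Rightarrow> 'a set"

definition multigraph :: "('a, 'b) multigraph \<Rightarrow> bool" where
  "multigraph T \<longleftrightarrow> finite (verts T) \<and> finite (edges T) \<and>
     (\<forall>x\<in>edges T. \<exists>i\<in>verts T. \<exists>j\<in>verts T. ends T x = {i, j})"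

text \<open>The number \<open>e\<^sub>i\<^sub>j\<close>; for \<open>i = j\<close> the endpoint set is a singleton and loops are counted.\<close>

definition mult_edge :: "('a, 'b) multigraph \<Rightarrow> 'a \<Rightarrow> 'a \<Rightarrow> nat" where
  "mult_edge T i j = card {x \<in> edges T. ends T x = {i, j}}"

definition deg :: "('a, 'b) multigraph \<Rightarrow> 'a \<Rightarrow> nat" where
  "deg T i = (\<Sum>j\<in>verts T. mult_edge T i j)"

section \<open>Thick trees with loops\<close>

text \<open>The underlying simple graph \<open>T'\<close> is represented by its vertex set \<open>verts T\<close> and
  its adjacency relation. The notion of tree of the AFP entry Graph\_Theory forbids directed
  cycles, hence also the 2-cycles of a symmetric digraph, so it does not apply here.\<close>

definition simple_adj :: "('a, 'b) multigraph \<Rightarrow> 'a \<Rightarrow> 'a \<Rightarrow> bool" where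
  "simple_adj T i j \<longleftrightarrow> i \<in> verts T \<and> j \<in> verts T \<and> i \<noteq> j \<and> mult_edge T i j \<noteq> 0"

definition simple_path :: "('a, 'b) multigraph \<Rightarrow> 'a \<Rightarrow> 'a \<Rightarrow> 'a list \<Rightarrow> bool" where
  "simple_path T i j p \<longleftrightarrow> p \<noteq> [] \<and> hd p = i \<and> last p = j \<and> set p \<subseteq> verts T \<and>
     distinct p \<and> successively (simple_adj T) p"

definition simple_cycle :: "('a, 'b) multigraph \<Rightarrow> 'a list \<Rightarrow> bool" where
  "simple_cycle T c \<longleftrightarrow> length c \<ge> 3 \<and> distinct c \<and> successively (simple_adj T) c \<and>
     simple_adj T (last c) (hd c)"

definition thick_tree :: "('a, 'b) multigraph \<Rightarrow> bool" where
  "thick_tree T \<longleftrightarrow> multigraph T \<and> verts T \<noteq> {} \<and>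
     (\<forall>i\<in>verts T. \<forall>j\<in>verts T. \<exists>p. simple_path T i j p) \<and> (\<nexists>c. simple_cycle T c)"

definition nonsink :: "('a, 'b) multigraph \<Rightarrow> 'a \<Rightarrow> 'a set" where
  "nonsink T s = verts T - {s}"

definition leaf :: "('a, 'b) multigraph \<Rightarrow> 'a \<Rightarrow> 'a \<Rightarrow> bool" where
  "leaf T s i \<longleftrightarrow> i \<in> nonsink T s \<and> card {j. simple_adj T i j} = 1"

definition succ_eq :: "('a, 'b) multigraph \<Rightarrow> 'a \<Rightarrow> 'a \<Rightarrow> 'a \<Rightarrow> bool" where
  "succ_eq T s i j \<longleftrightarrow> i \<in> verts T \<and> j \<in> set (THE p. simple_path T i s p)"

definition succ_strict :: "('a, 'b) multigraph \<Rightarrow> 'a \<Rightarrow> 'a \<Rightarrow> 'a \<Rightarrow> bool" where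
  "succ_strict T s i j \<longleftrightarrow> succ_eq T s i j \<and> i \<noteq> j"

definition parent :: "('a, 'b) multigraph \<Rightarrow> 'a \<Rightarrow> 'a \<Rightarrow> 'a" where
  "parent T s j = (THE k. simple_adj T j k \<and> succ_strict T s j k)"

text \<open>The multiplicity \<open>e\<^sub>j\<^sub>,\<^sub>p\<^sub>(\<^sub>j\<^sub>)\<close>.\<close>

definition parent_mult :: "('a, 'b) multigraph \<Rightarrow> 'a \<Rightarrow> 'a \<Rightarrow> nat" where
  "parent_mult T s j = mult_edge T j (parent T s j)"

section \<open>The sandpile group\<close>

text \<open>Vectors indexed by the non-sink vertices are extensional functions, as in
  \<open>product_group\<close>.\<close>

definition configs :: "('a, 'b) multigraph \<Rightarrow> 'a \<Rightarrow> ('a \<Rightarrow> nat) set" where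
  "configs T s = (nonsink T s \<rightarrow>\<^sub>E UNIV)"

definition unstable :: "('a, 'b) multigraph \<Rightarrow> ('a \<Rightarrow> nat) \<Rightarrow> 'a \<Rightarrow> bool" where
  "unstable T u i \<longleftrightarrow> \<not> u i < deg T i"

definition stable :: "('a, 'b) multigraph \<Rightarrow> 'a \<Rightarrow> ('a \<Rightarrow> nat) \<Rightarrow> bool" where
  "stable T s u \<longleftrightarrow> (\<forall>i\<in>nonsink T s. \<not> unstable T u i)"

text \<open>Only unstable vertices are toppled, so the subtraction is never truncated.\<close>

definition topple :: "('a, 'b) multigraph \<Rightarrow> 'a \<Rightarrow> 'a \<Rightarrow> ('a \<Rightarrow> nat) \<Rightarrow> ('a \<Rightarrow> nat)" where
  "topple T s i u = (\<lambda>j\<in>nonsink T s.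
     if j = i then u i - deg T i + mult_edge T i i else u j + mult_edge T i j)"

definition topple_step :: "('a, 'b) multigraph \<Rightarrow> 'a \<Rightarrow> ('a \<Rightarrow> nat) \<Rightarrow> ('a \<Rightarrow> nat) \<Rightarrow> bool" where
  "topple_step T s u w \<longleftrightarrow> (\<exists>i\<in>nonsink T s. unstable T u i \<and> w = topple T s i u)"

definition stabilization :: "('a, 'b) multigraph \<Rightarrow> 'a \<Rightarrow> ('a \<Rightarrow> nat) \<Rightarrow> ('a \<Rightarrow> nat)" where
  "stabilization T s u = (THE w. (topple_step T s)\<^sup>*\<^sup>* u w \<and> stable T s w)"

definition sandpile_add ::
  "('a, 'b) multigraph \<Rightarrow> 'a \<Rightarrow> ('a \<Rightarrow> nat) \<Rightarrow> ('a \<Rightarrow> nat) \<Rightarrow> ('a \<Rightarrow> nat)" where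
  "sandpile_add T s u v = stabilization T s (\<lambda>j\<in>nonsink T s. u j + v j)"

definition recurrent :: "('a, 'b) multigraph \<Rightarrow> 'a \<Rightarrow> ('a \<Rightarrow> nat) \<Rightarrow> bool" where
  "recurrent T s u \<longleftrightarrow> u \<in> configs T s \<and>
     (\<forall>v\<in>configs T s. \<exists>w\<in>configs T s. sandpile_add T s v w = u)"

definition sandpile_group :: "('a, 'b) multigraph \<Rightarrow> 'a \<Rightarrow> ('a \<Rightarrow> nat) monoid" where
  "sandpile_group T s = \<lparr>carrier = {u. recurrent T s u}, monoid.mult = sandpile_add T s,
     one = (THE z. recurrent T s z \<and> (\<forall>u. recurrent T s u \<longrightarrow> sandpile_add T s z u = u))\<rparr>"

section \<open>The maps of the theorem\<close>

text \<open>An element of \<open>integer_mod_group n\<close> with \<open>n > 0\<close> is its own standard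
  representative in \<open>{0..<int n}\<close>.\<close>

definition residue_product :: "('a, 'b) multigraph \<Rightarrow> 'a \<Rightarrow> ('a \<Rightarrow> int) monoid" where
  "residue_product T s =
     product_group (nonsink T s) (\<lambda>j. integer_mod_group (parent_mult T s j))"

definition phi :: "('a, 'b) multigraph \<Rightarrow> 'a \<Rightarrow> ('a \<Rightarrow> nat) \<Rightarrow> ('a \<Rightarrow> int)" where
  "phi T s u = (\<lambda>j\<in>nonsink T s.
     (\<Sum>i | i \<in> nonsink T s \<and> succ_eq T s i j. int (u i)) mod int (parent_mult T s j))"

definition phi_inv :: "('a, 'b) multigraph \<Rightarrow> 'a \<Rightarrow> ('a \<Rightarrow> int) \<Rightarrow> ('a \<Rightarrow> nat)" where
  "phi_inv T s = inv_into (carrier (sandpile_group T s)) (phi T s)"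

text \<open>The map \<open>f\<^sub>j\<close>. At a leaf without loops the window is \<open>{0..e-1}\<close> with \<open>e\<close> the parent
  multiplicity, so \<open>f\<^sub>j\<close> fixes standard representatives. At a leaf with loops the window starts
  at the positive number of loops, so there \<open>f\<^sub>j\<close> cannot be dropped from the recursion for
  the inverse.\<close>

definition window_rep :: "('a, 'b) multigraph \<Rightarrow> 'a \<Rightarrow> 'a \<Rightarrow> int \<Rightarrow> int" where
  "window_rep T s j m = (THE r.
     r \<in> {int (deg T j) - int (parent_mult T s j) .. int (deg T j) - 1} \<and>
     [r = m] (mod int (parent_mult T s j)))"

end

theory Submission
  imports Defs "HOL-Library.Confluence"
begin

text \<open>The edges between the subtree above \<open>j\<close> and its complement are the \<open>e\<^sub>j\<^sub>,\<^sub>p\<^sub>(\<^sub>j\<^sub>)\<close>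
  edges from \<open>j\<close> to its parent. Hence a toppling changes the number of grains in that subtree
  by a multiple of this multiplicity, so \<open>\<phi>\<close> is invariant under stabilization and additive.
  For the same reason, applying Dhar's burning criterion to the subtree above \<open>j\<close> shows that
  a configuration with every vertex unstable stabilizes into the box of (i): at every vertex
  other than \<open>j\<close> the criterion would contradict stability. On the box \<open>\<phi>\<close> is injective,
  because its values determine a configuration successively from the leaves down to the sink,
  and counting makes it bijective. Adding multiples of \<open>\<Prod>\<^sub>j e\<^sub>j\<^sub>,\<^sub>p\<^sub>(\<^sub>j\<^sub>)\<close> therefore reaches every
  element of the box from every configuration, so the box is the set of recurrent
  configurations. The multiset of moduli is the multiset of edge multiplicities of the
  underlying tree, whatever the sink.\<close>

section \<open>Paths and subtrees\<close>

lemma mult_edge_commute: "mult_edge T i j = mult_edge T j i"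
  by (simp add: mult_edge_def insert_commute)

lemma simple_adj_commute: "simple_adj T i j \<longleftrightarrow> simple_adj T j i"
  by (auto simp: simple_adj_def mult_edge_commute)

lemma simple_adj_ends:
  "simple_adj T i j \<Longrightarrow> i \<in> verts T \<and> j \<in> verts T \<and> i \<noteq> j \<and> mult_edge T i j > 0"
  by (simp add: simple_adj_def)

lemma successively_simple_adj_rev:
  "successively (simple_adj T) (rev p) \<longleftrightarrow> successively (simple_adj T) p"
proof -
  have "(\<lambda>i j. simple_adj T j i) = simple_adj T"
    by (intro ext) (rule simple_adj_commute)
  then show ?thesis by (simp only: successively_rev)
qed

lemma simple_path_Cons:
  "simple_path T i j (k # p) \<longleftrightarrow> k = i \<and> i \<in> verts T \<and> i \<notin> set p \<and>
     (if p = [] then i = j else simple_adj T i (hd p) \<and> simple_path T (hd p) j p)"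
  by (auto simp: simple_path_def successively_Cons)

lemma simple_path_ends: "simple_path T i j p \<Longrightarrow> i \<in> set p \<and> j \<in> set p"
  by (auto simp: simple_path_def)

text \<open>Where two paths first part, following one to its first vertex on the other and returning
  along that one closes a cycle.\<close>

lemma simple_path_unique:
  assumes "\<nexists>c. simple_cycle T c" "simple_path T i j p" "simple_path T i j q"
  shows "p = q"
  using assms(2,3)
proof (induction p arbitrary: i q)
  case Nil
  then show ?case by (simp add: simple_path_def)
next
  case (Cons k p)
  from Cons.prems obtain q' where q: "q = i # q'"
    by (cases q) (auto simp: simple_path_def)
  have k: "k = i" using Cons.prems(1) by (simp add: simple_path_Cons)
  have "p = q'"
  proof (cases "p = [] \<or> q' = []")
    case True
    with Cons.prems show ?thesis
      unfolding q by (auto simp: simple_path_def split: if_splits)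
  next
    case False
    then have ne: "p \<noteq> []" "q' \<noteq> []" by auto
    from Cons.prems ne have p: "simple_adj T i (hd p)" "simple_path T (hd p) j p" "i \<notin> set p"
      and q': "simple_adj T i (hd q')" "simple_path T (hd q') j q'" "i \<notin> set q'"
      unfolding q by (auto simp: simple_path_Cons)
    show ?thesis
    proof (cases "hd p = hd q'")
      case True
      with Cons.IH p q' show ?thesis by auto
    next
      case False
      have "j \<in> set p" "j \<in> set q'"
        using p(2) q'(2) by (auto dest: simple_path_ends)
      then have "\<exists>x\<in>set p. x \<in> set q'" by blast
      then obtain p1 x p2 where p12: "p = p1 @ x # p2" "x \<in> set q'" "set p1 \<inter> set q' = {}"
        by (auto dest!: split_list_first_prop)
      then obtain q1 q2 where q12: "q' = q1 @ x # q2"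
        by (meson split_list)
      \<comment> \<open>\<open>x\<close> is the first vertex of \<open>p\<close> on
        \<open>q'\<close>, so \<open>p1\<close> avoids \<open>q'\<close> and nothing repeats; as the
        heads differ, the length is at least 3.\<close>
      let ?c = "i # p1 @ x # rev q1"
      have "p1 \<noteq> [] \<or> q1 \<noteq> []"
        using False p12 q12 by auto
      then have "length ?c \<ge> 3" by (cases p1; cases q1) auto
      moreover have "distinct ?c"
        using p q' p12 q12 unfolding simple_path_def by auto
      moreover have "successively (simple_adj T) ?c"
      proof -
        have "successively (simple_adj T) (p1 @ x # p2)" "successively (simple_adj T) (q1 @ x # q2)"
          using p(2) q'(2) p12(1) q12 by (simp_all add: simple_path_def)
        moreover have "simple_adj T i (hd (p1 @ [x]))"
          using p(1) p12(1) by (cases p1) auto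
        ultimately show ?thesis
          by (cases p1) (auto simp: successively_Cons successively_append_iff hd_rev hd_append
              successively_simple_adj_rev simple_adj_commute[of T x] simp del: successively_rev)
      qed
      moreover have "simple_adj T (last ?c) (hd ?c)"
        using q'(1) q12 by (cases q1) (auto simp: simple_adj_commute)
      ultimately have "simple_cycle T ?c" by (simp only: simple_cycle_def)
      with assms(1) show ?thesis by blast
    qed
  qed
  with q k show ?case by simp
qed

text \<open>The edge set of the underlying simple tree: an index set for the moduli in which no sink
  occurs.\<close>

definition thick_edges :: "('a, 'b) multigraph \<Rightarrow> 'a set set" where
  "thick_edges T = {{i, k} |i k. simple_adj T i k}"

text \<open>Distinct congruent integers are at least \<open>n\<close> apart. This serves both
  injectivity of \<open>phi\<close> and uniqueness in \<open>window_rep\<close>.\<close>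

lemma cong_window_unique:
  fixes a b n r r' :: int
  assumes "[r = r'] (mod n)" "r \<in> {b - n..<b}" "r' \<in> {b - n..<b}"
  shows "r = r'"
proof (rule ccontr)
  assume "r \<noteq> r'"
  moreover have "n dvd r - r'" using assms(1) by (simp add: cong_iff_dvd_diff)
  ultimately have "n \<le> \<bar>r - r'\<bar>" using dvd_imp_le_int[of "r - r'" n] by simp
  with assms(2,3) show False by auto
qed

text \<open>Multiplication is coordinatewise, so relabelling along \<open>g\<close> is a
  homomorphism. It will trade vertices for edges as indices.\<close>

lemma product_group_reindex:
  assumes g: "bij_betw g I J"
  shows "product_group J G \<cong> product_group I (\<lambda>i. G (g i))"
proof -
  let ?h = "\<lambda>f. \<lambda>i\<in>I. f (g i)" and ?k = "\<lambda>f. \<lambda>j\<in>J. f (inv_into I g j)"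
  have gJ: "g i \<in> J" if "i \<in> I" for i using g that by (auto simp: bij_betw_def)
  have inv: "inv_into I g j \<in> I" "g (inv_into I g j) = j" if "j \<in> J" for j
    using g that by (auto simp: bij_betw_def inv_into_into f_inv_into_f)
  have inv': "inv_into I g (g i) = i" if "i \<in> I" for i
    using g that by (simp add: bij_betw_def)
  have "bij_betw ?h (carrier (product_group J G)) (carrier (product_group I (\<lambda>i. G (g i))))"
  proof (rule bij_betw_byWitness[where f' = ?k])
    show "\<forall>f\<in>carrier (product_group J G). ?k (?h f) = f"
      by (auto simp: fun_eq_iff inv PiE_def extensional_def)
    show "\<forall>f\<in>carrier (product_group I (\<lambda>i. G (g i))). ?h (?k f) = f"
      by (auto simp: fun_eq_iff inv' gJ PiE_def extensional_def)
    show "?h ` carrier (product_group J G) \<subseteq> carrier (product_group I (\<lambda>i. G (g i)))"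
      by (auto simp: gJ)
    show "?k ` carrier (product_group I (\<lambda>i. G (g i))) \<subseteq> carrier (product_group J G)"
      using inv by (auto simp: PiE_iff) metis
  qed
  moreover have "?h \<in> hom (product_group J G) (product_group I (\<lambda>i. G (g i)))"
    by (rule homI) (auto simp: gJ fun_eq_iff)
  ultimately show ?thesis by (auto simp: is_iso_def iso_def)
qed

section \<open>Rooted trees: sink paths, parents and depth\<close>

locale rooted_thick_tree =
  fixes T :: "('a, 'b) multigraph" and s :: 'a
  assumes tree: "thick_tree T" and sink: "s \<in> verts T"
begin

abbreviation "V \<equiv> verts T"
abbreviation "V0 \<equiv> nonsink T s"
abbreviation "m \<equiv> mult_edge T"
abbreviation "d \<equiv> deg T"
abbreviation "par \<equiv> parent T s"
abbreviation "e \<equiv> parent_mult T s"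

definition sink_path :: "'a \<Rightarrow> 'a list" where
  "sink_path i = (THE p. simple_path T i s p)"

text \<open>Vertices rather than edges are counted, so the sink has depth 1.\<close>

definition depth :: "'a \<Rightarrow> nat" where
  "depth i = length (sink_path i)"

text \<open>The sink is left out even for \<open>j = s\<close>, where the set is all of
  \<open>V0\<close>; hence the extra disjunct in \<open>subtree_step\<close>.\<close>

definition subtree :: "'a \<Rightarrow> 'a set" where
  "subtree j = {i \<in> V0. succ_eq T s i j}"

lemma finite_V [simp]: "finite V" and finite_V0 [simp]: "finite V0"
  using tree by (auto simp: thick_tree_def multigraph_def nonsink_def)

lemma V0_iff: "i \<in> V0 \<longleftrightarrow> i \<in> V \<and> i \<noteq> s"
  by (simp add: nonsink_def)

lemma acyclic: "\<nexists>c. simple_cycle T c"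
  using tree by (simp add: thick_tree_def)

text \<open>Connectedness gives existence and acyclicity uniqueness, which resolves the definite
  description in \<open>sink_path\<close>.\<close>

lemma simple_path_iff:
  assumes "i \<in> V" shows "simple_path T i s p \<longleftrightarrow> p = sink_path i"
proof -
  have "\<forall>i\<in>V. \<forall>j\<in>V. \<exists>p. simple_path T i j p" using tree by (simp add: thick_tree_def)
  then obtain q where q: "simple_path T i s q" using sink assms by blast
  then have "simple_path T i s (sink_path i)"
    unfolding sink_path_def using simple_path_unique[OF acyclic _ q] by (rule theI)
  then show ?thesis using simple_path_unique[OF acyclic] by blast
qed

lemma sink_path: "i \<in> V \<Longrightarrow> simple_path T i s (sink_path i)"
  by (simp add: simple_path_iff)

lemma sink_path_sink: "sink_path s = [s]"
  using simple_path_iff[OF sink, of "[s]"] sink by (simp add: simple_path_Cons)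

lemma succ_eq_iff: "succ_eq T s i j \<longleftrightarrow> i \<in> V \<and> j \<in> set (sink_path i)"
  by (simp add: succ_eq_def sink_path_def)

text \<open>If \<open>i\<close> is not on the path from \<open>k\<close>, it can be prepended.
  Otherwise it comes directly after \<open>k\<close>, as vertices in between would form a cycle with
  the edge.\<close>

lemma adj_sink_path:
  assumes "simple_adj T i k"
  shows "sink_path i = i # sink_path k \<or> sink_path k = k # sink_path i"
proof -
  have V: "i \<in> V" "k \<in> V" and "i \<noteq> k" using assms by (auto dest: simple_adj_ends)
  note pk = sink_path[OF V(2)]
  show ?thesis
  proof (cases "i \<in> set (sink_path k)")
    case False
    have "sink_path k \<noteq> []" "hd (sink_path k) = k" using pk by (auto simp: simple_path_def)
    then have "simple_path T i s (i # sink_path k)"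
      using pk False V assms by (simp add: simple_path_Cons)
    then show ?thesis using simple_path_iff[OF V(1)] by simp
  next
    case True
    then obtain r1 r2 where r: "sink_path k = r1 @ i # r2" by (meson split_list)
    with pk \<open>i \<noteq> k\<close> obtain r0 where r1: "r1 = k # r0"
      by (cases r1) (auto simp: simple_path_def)
    have "simple_path T i s (i # r2)"
      using pk unfolding r by (auto simp: simple_path_def successively_append_iff)
    then have r2: "i # r2 = sink_path i" using simple_path_iff[OF V(1)] by simp
    have "r0 = []"
    proof (rule ccontr)
      assume "r0 \<noteq> []"
      then have "length (k # r0 @ [i]) \<ge> 3" by (cases r0) auto
      moreover have "distinct (k # r0 @ [i])" "successively (simple_adj T) (k # r0 @ [i])"
        using pk unfolding r r1
        by (auto simp: simple_path_def successively_append_iff successively_Cons hd_append)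
      ultimately have "simple_cycle T (k # r0 @ [i])"
        using assms by (simp add: simple_cycle_def)
      then show False using acyclic by blast
    qed
    then show ?thesis using r r1 r2 by simp
  qed
qed

lemma parent_eqI:
  assumes "simple_adj T i k" "sink_path i = i # sink_path k"
  shows "par i = k"
  unfolding parent_def
proof (rule the_equality)
  have V: "i \<in> V" "k \<in> V" "i \<noteq> k" using assms(1) by (auto dest: simple_adj_ends)
  then have "k \<in> set (sink_path k)" using sink_path[of k] by (auto dest: simple_path_ends)
  then show "simple_adj T i k \<and> succ_strict T s i k"
    using assms V by (auto simp: succ_strict_def succ_eq_iff)
  fix l assume l: "simple_adj T i l \<and> succ_strict T s i l"
  then have lV: "l \<in> V" and "l \<in> set (sink_path i)"
    by (auto dest: simple_adj_ends simp: succ_strict_def succ_eq_iff)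
  \<comment> \<open>Excludes the other alternative of \<open>adj_sink_path\<close>, in which
    \<open>l\<close> would occur twice on its own path.\<close>
  moreover have "distinct (sink_path l)" using sink_path[OF lV] by (simp add: simple_path_def)
  ultimately have "sink_path i = i # sink_path l"
    using adj_sink_path[of i l] l by auto
  then have "sink_path l = sink_path k" using assms by simp
  then show "l = k" using sink_path[OF lV] sink_path[OF V(2)] by (auto simp: simple_path_def)
qed

lemma parent:
  assumes "j \<in> V0"
  shows adj_parent: "simple_adj T j (par j)" and sink_path_parent: "sink_path j = j # sink_path (par j)"
proof -
  have V: "j \<in> V" "j \<noteq> s" using assms by (auto simp: V0_iff)
  obtain p where p: "sink_path j = j # p" "p \<noteq> []"
    using sink_path[OF V(1)] V
    by (cases "sink_path j")
      (auto simp: simple_path_Cons simple_path_def[of _ _ _ "[]"] split: if_splits)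
  then have *: "simple_adj T j (hd p)" "simple_path T (hd p) s p"
    using sink_path[OF V(1)] by (auto simp: simple_path_Cons)
  then have hd: "sink_path (hd p) = p" using simple_path_iff[of "hd p" p] simple_adj_ends[of T j] by simp
  then have "par j = hd p" using parent_eqI[OF *(1)] p by simp
  with * p hd show "simple_adj T j (par j)" "sink_path j = j # sink_path (par j)" by simp_all
qed

lemma parent_in_V: "j \<in> V0 \<Longrightarrow> par j \<in> V"
  using adj_parent simple_adj_ends by metis

lemma parent_mult_pos: "j \<in> V0 \<Longrightarrow> e j > 0"
  unfolding parent_mult_def using adj_parent simple_adj_ends by metis

lemma depth_parent: "j \<in> V0 \<Longrightarrow> depth j = Suc (depth (par j))"
  by (simp add: depth_def sink_path_parent)

lemma adj_cases:
  assumes "simple_adj T i k"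
  obtains "i \<in> V0" "k = par i" | "k \<in> V0" "i = par k"
proof -
  have V: "i \<in> V" "k \<in> V" "i \<noteq> k" using assms by (auto dest: simple_adj_ends)
  have *: "x \<in> V0" if "sink_path x = x # sink_path y" "x \<in> V" "y \<in> V" for x y
  proof -
    have "sink_path y \<noteq> []" using sink_path[OF that(3)] by (simp add: simple_path_def)
    with that show ?thesis using sink_path_sink by (auto simp: V0_iff)
  qed
  from adj_sink_path[OF assms] show thesis
  proof
    assume "sink_path i = i # sink_path k"
    with * V parent_eqI[OF assms] that(1) show thesis by metis
  next
    assume "sink_path k = k # sink_path i"
    moreover have "simple_adj T k i" using assms by (simp add: simple_adj_commute)
    ultimately show thesis using * V parent_eqI that(2) by metis
  qed
qed

section \<open>Subtrees and the edges leaving them\<close>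

lemma subtree_subset: "subtree j \<subseteq> V0"
  by (auto simp: subtree_def)

lemma finite_subtree [simp]: "finite (subtree j)"
  using finite_subset[OF subtree_subset] by simp

lemma self_in_subtree: "j \<in> V0 \<Longrightarrow> j \<in> subtree j"
  by (simp add: subtree_def succ_eq_iff sink_path_parent V0_iff)

lemma subtree_step: "i \<in> V0 \<Longrightarrow> i \<in> subtree j \<longleftrightarrow> i = j \<or> par i \<in> subtree j \<or> (par i = s \<and> j = s)"
  using parent_in_V[of i] sink_path_sink
  by (auto simp: subtree_def succ_eq_iff sink_path_parent V0_iff)

lemma parent_notin_subtree: "j \<in> V0 \<Longrightarrow> par j \<notin> subtree j"
  using sink_path[of j] by (auto simp: subtree_def succ_eq_iff V0_iff simple_path_def sink_path_parent)

text \<open>Edges join child and parent; children of members are members, and so are parents of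
  members other than \<open>j\<close>.\<close>

lemma subtree_boundary:
  assumes "j \<in> V0" "i \<in> subtree j" "k \<in> V" "k \<notin> subtree j" "m i k \<noteq> 0"
  shows "i = j \<and> k = par j"
proof -
  have V0: "i \<in> V0" "i \<in> V" "i \<noteq> k" "j \<noteq> s" using assms by (auto simp: subtree_def V0_iff)
  then have "simple_adj T i k" using assms by (simp add: simple_adj_def)
  then show ?thesis
  proof (cases rule: adj_cases)
    case 1 then show ?thesis using subtree_step V0 assms by metis
  next
    case 2 then show ?thesis using subtree_step assms by metis
  qed
qed

lemma deg_subset_sum:
  assumes "i \<in> V" "F \<subseteq> V" "\<And>k. k \<in> V - F \<Longrightarrow> m i k = 0"
  shows "(\<Sum>k\<in>F. m i k) = d i"
  unfolding deg_def using assms by (intro sum.mono_neutral_left) auto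

lemma subtree_sum_mult_edge_inner:
  assumes "j \<in> V0" "i \<in> subtree j" "i \<noteq> j"
  shows "(\<Sum>k\<in>subtree j. m i k) = d i"
proof (rule deg_subset_sum)
  show "i \<in> V" "subtree j \<subseteq> V" using assms by (auto simp: V0_iff subtree_def)
qed (use assms subtree_boundary in blast)

lemma subtree_sum_mult_edge_root:
  assumes "j \<in> V0"
  shows "(\<Sum>k\<in>subtree j. m j k) + e j = d j"
proof -
  have "(\<Sum>k\<in>insert (par j) (subtree j). m j k) = d j"
  proof (rule deg_subset_sum)
    show "j \<in> V" "insert (par j) (subtree j) \<subseteq> V"
      using assms parent_in_V[of j] by (auto simp: V0_iff subtree_def)
  qed (use assms subtree_boundary self_in_subtree in blast)
  then show ?thesis
    using parent_notin_subtree[OF assms] by (simp add: parent_mult_def)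
qed

text \<open>Each single summand is 0 or \<open>e j\<close>: from outside, only \<open>par j\<close>
  sends grains into the subtree, and only to \<open>j\<close>.\<close>

lemma parent_mult_dvd_subtree_sum_outer:
  assumes "j \<in> V0" "i \<in> V" "i \<notin> subtree j"
  shows "e j dvd (\<Sum>k\<in>subtree j. m i k)"
proof (rule dvd_sum)
  fix k assume k: "k \<in> subtree j"
  show "e j dvd m i k"
  proof (cases "m k i = 0")
    case False
    then have "k = j \<and> i = par j" using subtree_boundary[of j k i] assms k by simp
    then show ?thesis by (simp add: parent_mult_def mult_edge_commute)
  qed (simp add: mult_edge_commute)
qed

lemma deg_ge_parent_mult: "j \<in> V0 \<Longrightarrow> e j \<le> d j"
  using subtree_sum_mult_edge_root by (metis le_add2)

section \<open>Stabilization\<close>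

abbreviation "step \<equiv> topple_step T s"
abbreviation "stab \<equiv> stabilization T s"

definition plus_config :: "('a \<Rightarrow> nat) \<Rightarrow> ('a \<Rightarrow> nat) \<Rightarrow> 'a \<Rightarrow> nat" where
  "plus_config u v = (\<lambda>j\<in>V0. u j + v j)"

lemma plus_config_in_configs [simp]: "plus_config u v \<in> configs T s"
  by (simp add: plus_config_def configs_def)

lemma sandpile_add_eq: "sandpile_add T s u v = stab (plus_config u v)"
  by (simp add: sandpile_add_def plus_config_def)

lemma step_toppled:
  assumes "step u w"
  shows "\<exists>i\<in>V0. d i \<le> u i \<and>
    (\<forall>k\<in>V0. int (w k) = int (u k) + int (m i k) - (if k = i then int (d i) else 0))"
  using assms by (force simp: topple_step_def topple_def unstable_def)

lemma step_in_configs: "step u w \<Longrightarrow> w \<in> configs T s"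
  by (auto simp: topple_step_def topple_def configs_def)

lemma steps_in_configs: "step\<^sup>*\<^sup>* u w \<Longrightarrow> u \<in> configs T s \<Longrightarrow> w \<in> configs T s"
  by (induction rule: rtranclp_induct) (auto intro: step_in_configs)

section \<open>Termination by a weighted grain count\<close>

lemma depth_le_card:
  assumes "k \<in> V" shows "depth k \<le> card V"
proof -
  have "distinct (sink_path k)" "set (sink_path k) \<subseteq> V"
    using sink_path[OF assms] by (auto simp: simple_path_def)
  then show ?thesis
    unfolding depth_def by (metis card_mono distinct_card finite_V)
qed

definition base :: int where "base = 2 + (\<Sum>i\<in>V. int (d i))"

text \<open>Concave in the depth, so steeply that the gain of the parent edge of a toppling vertex
  outweighs the loss along all its other edges.\<close>

definition weight :: "'a \<Rightarrow> int" where
  "weight k = base ^ card V - base ^ (card V - depth k)"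

lemma base_gt: "i \<in> V \<Longrightarrow> int (d i) + 1 < base"
  unfolding base_def using member_le_sum[of i V "\<lambda>i. int (d i)"] by simp

lemma base_ge: "2 \<le> base"
  unfolding base_def by (simp add: sum_nonneg)

lemma weight_nonneg: "0 \<le> weight k"
  unfolding weight_def using base_ge by (simp add: power_increasing)

text \<open>A toppling at \<open>i\<close> removes weight \<open>int (d i) * weight i\<close> and
  adds the left-hand side, so the total weight drops.\<close>

lemma weight_superharmonic:
  assumes i: "i \<in> V0"
  shows "(\<Sum>k\<in>V0. int (m i k) * weight k) < int (d i) * weight i"
proof -
  let ?W = "base ^ (card V - depth i)" and ?p = "par i"
  have iV: "i \<in> V" and pV: "?p \<in> V" using i parent_in_V by (auto simp: V0_iff)
  have W: "0 < ?W" using base_ge by simp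
  \<comment> \<open>The parent is one level nearer to the sink, which contributes one further factor
    \<open>base\<close>.\<close>
  have p: "base ^ (card V - depth ?p) = base * ?W"
    using depth_parent[OF i] depth_le_card[OF iV] by (simp flip: power_Suc add: Suc_diff_Suc)
  have mp: "1 \<le> int (m i ?p)" using parent_mult_pos[OF i] by (simp add: parent_mult_def)
  have "0 < ?W * (base - 1 - int (d i))" using W base_gt[OF iV] by simp
  also have "\<dots> \<le> int (m i ?p) * (base * ?W) - int (d i) * ?W"
  proof -
    have "1 * (base * ?W) \<le> int (m i ?p) * (base * ?W)"
      using mp W base_ge by (intro mult_right_mono) auto
    moreover have "?W * (base - 1 - int (d i)) \<le> base * ?W - int (d i) * ?W"
      using W by (simp add: algebra_simps)
    ultimately show ?thesis by linarith
  qed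
  \<comment> \<open>The terms of all vertices other than the parent are nonnegative.\<close>
  also have "\<dots> \<le> (\<Sum>k\<in>V. int (m i k) * base ^ (card V - depth k)) - int (d i) * ?W"
    using member_le_sum[of ?p V "\<lambda>k. int (m i k) * base ^ (card V - depth k)"] pV base_ge
    by (simp add: p)
  also have "\<dots> = (\<Sum>k\<in>V. int (m i k) * (weight i - weight k))"
    by (simp add: weight_def deg_def sum_subtractf right_diff_distrib sum_distrib_right)
  also have "\<dots> = int (d i) * weight i - (\<Sum>k\<in>V. int (m i k) * weight k)"
    by (simp add: deg_def sum_subtractf right_diff_distrib sum_distrib_right)
  finally have "(\<Sum>k\<in>V. int (m i k) * weight k) < int (d i) * weight i" by simp
  moreover have "(\<Sum>k\<in>V0. int (m i k) * weight k) \<le> (\<Sum>k\<in>V. int (m i k) * weight k)"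
    by (rule sum_mono2) (auto simp: V0_iff weight_nonneg)
  ultimately show ?thesis by simp
qed

lemma step_decreases_potential:
  assumes "step u w"
  shows "(\<Sum>k\<in>V0. int (w k) * weight k) < (\<Sum>k\<in>V0. int (u k) * weight k)"
proof -
  obtain i where i: "i \<in> V0" "d i \<le> u i"
    "\<And>k. k \<in> V0 \<Longrightarrow> int (w k) = int (u k) + int (m i k) - (if k = i then int (d i) else 0)"
    using step_toppled[OF assms] by blast
  have "(\<Sum>k\<in>V0. int (w k) * weight k) = (\<Sum>k\<in>V0. int (u k) * weight k
      + int (m i k) * weight k - (if k = i then int (d i) * weight i else 0))"
    by (rule sum.cong) (auto simp: i(3) algebra_simps)
  also have "\<dots> = (\<Sum>k\<in>V0. int (u k) * weight k) + (\<Sum>k\<in>V0. int (m i k) * weight k)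
      - int (d i) * weight i"
    using i(1) by (simp add: sum.distrib sum_subtractf)
  finally show ?thesis using weight_superharmonic[OF i(1)] by simp
qed

section \<open>Existence and uniqueness of the stabilization\<close>

lemma stable_iff: "stable T s u \<longleftrightarrow> (\<nexists>w. step u w)"
  by (auto simp: stable_def topple_step_def)

lemma ex_stabilization: "\<exists>w. step\<^sup>*\<^sup>* u w \<and> stable T s w"
proof (induction u rule: measure_induct_rule[of "\<lambda>u. nat (\<Sum>k\<in>V0. int (u k) * weight k)"])
  case (less u)
  show ?case
  proof (cases "stable T s u")
    case False
    then obtain w where w: "step u w" by (auto simp: stable_iff)
    have "0 \<le> (\<Sum>k\<in>V0. int (w k) * weight k)"
      by (intro sum_nonneg mult_nonneg_nonneg weight_nonneg) simp
    then have "nat (\<Sum>k\<in>V0. int (w k) * weight k) < nat (\<Sum>k\<in>V0. int (u k) * weight k)"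
      using step_decreases_potential[OF w] by linarith
    from less.IH[OF this] w show ?thesis by (meson converse_rtranclp_into_rtranclp)
  qed blast
qed

text \<open>As both vertices are unstable, the truncated subtractions are exact in either
  order.\<close>

lemma topple_commute:
  assumes "i \<noteq> k" "unstable T u i" "unstable T u k"
  shows "topple T s k (topple T s i u) = topple T s i (topple T s k u)"
  using assms by (auto simp: topple_def unstable_def fun_eq_iff)

lemma unstable_topple:
  assumes "i \<noteq> k" "k \<in> V0" "unstable T u k"
  shows "unstable T (topple T s i u) k"
  using assms by (auto simp: topple_def unstable_def)

text \<open>Topplings at distinct unstable vertices commute and do not disable each other, so every
  diamond closes in one step.\<close>

lemma confluent_step: "confluentp step"
proof (rule strong_confluentp_imp_confluentp, rule strong_confluentpI)
  fix x y z assume "step x y" "step x z"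
  then obtain i k where ik: "i \<in> V0" "k \<in> V0" "unstable T x i" "unstable T x k"
    "y = topple T s i x" "z = topple T s k x"
    by (auto simp: topple_step_def)
  show "\<exists>u. step\<^sup>*\<^sup>* y u \<and> step\<^sup>=\<^sup>= z u"
  proof (cases "i = k")
    case True
    with ik show ?thesis by auto
  next
    case False
    then have "step y (topple T s k y)" "step z (topple T s k y)"
      using ik topple_commute[of i k x] unstable_topple[of i k x] unstable_topple[of k i x]
      unfolding topple_step_def by metis+
    then show ?thesis by blast
  qed
qed

lemma stab_eqI:
  assumes "step\<^sup>*\<^sup>* u w" "stable T s w" shows "stab u = w"
  unfolding stabilization_def
proof (rule the_equality)
  fix w' assume w': "step\<^sup>*\<^sup>* u w' \<and> stable T s w'"
  then obtain x where "step\<^sup>*\<^sup>* w x" "step\<^sup>*\<^sup>* w' x"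
    using confluentpD[OF confluent_step] assms by metis
  then show "w' = w"
    using w' assms by (metis converse_rtranclpE stable_iff)
qed (use assms in blast)

lemma steps_stab: "step\<^sup>*\<^sup>* u (stab u)" and stable_stab: "stable T s (stab u)"
  using ex_stabilization[of u] stab_eqI by auto

lemma stab_steps: "step\<^sup>*\<^sup>* u w \<Longrightarrow> stab u = stab w"
  by (meson rtranclp_trans stab_eqI stable_stab steps_stab)

lemma stab_in_configs: "u \<in> configs T s \<Longrightarrow> stab u \<in> configs T s"
  using steps_in_configs steps_stab by blast

text \<open>Extra grains keep unstable vertices unstable. Hence stabilizing a summand can be
  postponed until after an addition.\<close>

lemma steps_plus_config: "step\<^sup>*\<^sup>* u w \<Longrightarrow> step\<^sup>*\<^sup>* (plus_config u v) (plus_config w v)"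
proof (induction rule: rtranclp_induct)
  case (step x y)
  then obtain i where i: "i \<in> V0" "unstable T x i" "y = topple T s i x"
    by (auto simp: topple_step_def)
  then have "unstable T (plus_config x v) i" "plus_config y v = topple T s i (plus_config x v)"
    by (auto simp: unstable_def plus_config_def topple_def fun_eq_iff)
  with i(1) have "topple_step T s (plus_config x v) (plus_config y v)"
    by (auto simp: topple_step_def)
  with step.IH show ?case by simp
qed simp

section \<open>Subtree sums\<close>

definition subtree_sum :: "('a \<Rightarrow> nat) \<Rightarrow> 'a \<Rightarrow> int" where
  "subtree_sum u j = (\<Sum>i\<in>subtree j. int (u i))"

lemma phi_eq: "phi T s u = (\<lambda>j\<in>V0. subtree_sum u j mod int (e j))"
  by (simp add: phi_def subtree_sum_def subtree_def)

text \<open>A toppling outside the subtree sends in a multiple of \<open>e j\<close>, one at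
  \<open>j\<close> loses exactly \<open>e j\<close> grains to the parent, and one elsewhere inside
  conserves the sum.\<close>

lemma subtree_sum_step:
  assumes "step u w" "j \<in> V0"
  shows "int (e j) dvd subtree_sum w j - subtree_sum u j"
proof -
  obtain i where i: "i \<in> V0" "d i \<le> u i"
    "\<And>k. k \<in> V0 \<Longrightarrow> int (w k) = int (u k) + int (m i k) - (if k = i then int (d i) else 0)"
    using step_toppled[OF assms(1)] by blast
  have "subtree_sum w j
      = (\<Sum>k\<in>subtree j. int (u k) + int (m i k) - (if k = i then int (d i) else 0))"
    unfolding subtree_sum_def
  proof (rule sum.cong)
    fix k assume "k \<in> subtree j"
    then have "k \<in> V0" using subtree_subset by blast
    then show "int (w k) = int (u k) + int (m i k) - (if k = i then int (d i) else 0)"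
      using i(3) by blast
  qed simp
  then have eq: "subtree_sum w j - subtree_sum u j
      = int (\<Sum>k\<in>subtree j. m i k) - (if i \<in> subtree j then int (d i) else 0)"
    by (simp add: sum.distrib sum_subtractf subtree_sum_def)
  show ?thesis
  proof (cases "i \<in> subtree j")
    case False
    then have "e j dvd (\<Sum>k\<in>subtree j. m i k)"
      using parent_mult_dvd_subtree_sum_outer assms(2) i(1) by (simp add: V0_iff)
    with eq False show ?thesis by (metis diff_zero int_dvd_int_iff)
  next
    case True
    show ?thesis
    proof (cases "i = j")
      case True
      then have "subtree_sum w j - subtree_sum u j = - int (e j)"
        using eq \<open>i \<in> subtree j\<close> subtree_sum_mult_edge_root[OF assms(2)] by (simp flip: of_nat_sum)
      then show ?thesis by simp
    next
      case False
      then show ?thesis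
        using eq True subtree_sum_mult_edge_inner[OF assms(2) True] by simp
    qed
  qed
qed

lemma phi_steps: "step\<^sup>*\<^sup>* u w \<Longrightarrow> phi T s w = phi T s u"
proof (induction rule: rtranclp_induct)
  case (step x y)
  then have "phi T s y = phi T s x"
    unfolding phi_eq using subtree_sum_step
    by (intro restrict_ext) (simp add: mod_eq_dvd_iff)
  with step.IH show ?case by simp
qed simp

lemma phi_stab: "phi T s (stab u) = phi T s u"
  using phi_steps steps_stab by blast

lemma subtree_sum_plus_config:
  "subtree_sum (plus_config u v) j = subtree_sum u j + subtree_sum v j"
  using subtree_subset[of j]
  by (auto simp: subtree_sum_def plus_config_def sum.distrib[symmetric] intro!: sum.cong)

lemma phi_add:
  "phi T s (sandpile_add T s u v) = (\<lambda>j\<in>V0. (phi T s u j + phi T s v j) mod int (e j))"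
  unfolding sandpile_add_eq phi_stab unfolding phi_eq by (auto simp: subtree_sum_plus_config mod_add_eq)

section \<open>Recurrent configurations\<close>

text \<open>Dhar's condition: no forbidden subconfigurations.\<close>

definition allowed :: "('a \<Rightarrow> nat) \<Rightarrow> bool" where
  "allowed u \<longleftrightarrow> (\<forall>F\<subseteq>V0. F \<noteq> {} \<longrightarrow> (\<exists>i\<in>F. (\<Sum>k\<in>F. m i k) \<le> u i))"

text \<open>A set without the toppled vertex loses no grains. Otherwise a witness for the set with
  that vertex removed still works, since the toppling adds exactly the missing term.\<close>

lemma allowed_step:
  assumes "allowed u" "step u w" shows "allowed w"
  unfolding allowed_def
proof (intro allI impI)
  fix F assume F: "F \<subseteq> V0" "F \<noteq> {}"
  then have fin: "finite F" using finite_subset finite_V0 by blast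
  obtain i where i: "i \<in> V0" "d i \<le> u i"
    "\<And>k. k \<in> V0 \<Longrightarrow> int (w k) = int (u k) + int (m i k) - (if k = i then int (d i) else 0)"
    using step_toppled[OF assms(2)] by blast
  have w: "k \<in> V0 \<Longrightarrow> k \<noteq> i \<Longrightarrow> w k = u k + m i k" for k using i(3)[of k] by simp
  have wi: "m i i \<le> w i" using i(3)[OF i(1)] i(2) by simp
  show "\<exists>l\<in>F. (\<Sum>k\<in>F. m l k) \<le> w l"
  proof (cases "i \<in> F")
    case False
    obtain l where l: "l \<in> F" "(\<Sum>k\<in>F. m l k) \<le> u l"
      using assms(1) F by (auto simp: allowed_def)
    moreover have "u l \<le> w l"
    proof -
      have "l \<in> V0" "l \<noteq> i" using l(1) F False by auto
      then show ?thesis using w by simp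
    qed
    ultimately show ?thesis using le_trans by blast
  next
    case True
    show ?thesis
    proof (cases "F = {i}")
      case True
      with wi show ?thesis by simp
    next
      case False
      then have "F - {i} \<noteq> {}" using \<open>i \<in> F\<close> by blast
      then obtain l where l: "l \<in> F - {i}" "(\<Sum>k\<in>F - {i}. m l k) \<le> u l"
        using assms(1) F by (metis allowed_def Diff_subset order_trans)
      then have "(\<Sum>k\<in>F. m l k) \<le> w l"
        using w[of l] F sum.remove[OF fin \<open>i \<in> F\<close>, of "m l"] by (auto simp: mult_edge_commute[of T l i])
      with l show ?thesis by blast
    qed
  qed
qed

text \<open>The truncated difference is exact by \<open>deg_ge_parent_mult\<close>.\<close>

definition box :: "('a \<Rightarrow> nat) set" where
  "box = {u \<in> configs T s. \<forall>j\<in>V0. u j < d j \<and> d j - e j \<le> u j}"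

lemma stab_large_in_box:
  assumes "u \<in> configs T s" "\<And>i. i \<in> V0 \<Longrightarrow> d i \<le> u i"
  shows "stab u \<in> box"
proof -
  have "allowed u"
    unfolding allowed_def
  proof (intro allI impI)
    fix F assume F: "F \<subseteq> V0" "F \<noteq> {}"
    then obtain i where i: "i \<in> F" by blast
    then have "(\<Sum>k\<in>F. m i k) \<le> d i"
      unfolding deg_def using F by (intro sum_mono2) (auto simp: V0_iff)
    with i F assms(2) show "\<exists>i\<in>F. (\<Sum>k\<in>F. m i k) \<le> u i" by force
  qed
  moreover have "allowed w" if "step\<^sup>*\<^sup>* u w" "allowed u" for w
    using that by (induction rule: rtranclp_induct) (auto intro: allowed_step)
  ultimately have al: "allowed (stab u)" using steps_stab by blast
  have st: "stab u j < d j" if "j \<in> V0" for j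
    using stable_stab[of u] that by (auto simp: stable_def unstable_def)
  have "d j - e j \<le> stab u j" if j: "j \<in> V0" for j
  proof -
    have "subtree j \<subseteq> V0" "subtree j \<noteq> {}" using subtree_subset self_in_subtree[OF j] by auto
    then obtain i where i: "i \<in> subtree j" "(\<Sum>k\<in>subtree j. m i k) \<le> stab u i"
      using al by (metis allowed_def)
    \<comment> \<open>At any other vertex of the subtree the sum is the full degree, which a stable
      vertex cannot reach.\<close>
    then have "i = j"
      using subtree_sum_mult_edge_inner[OF j i(1)] st[of i] subtree_subset by fastforce
    with i(2) have "(\<Sum>k\<in>subtree j. m j k) \<le> stab u j" by simp
    then show ?thesis using subtree_sum_mult_edge_root[OF j] by linarith
  qed
  with st show ?thesis using assms(1) stab_in_configs by (simp add: box_def)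
qed

section \<open>Injectivity on the box and the recurrence criterion\<close>

lemma subtree_sum_split:
  "j \<in> V0 \<Longrightarrow> subtree_sum u j = int (u j) + (\<Sum>i\<in>subtree j - {j}. int (u i))"
  unfolding subtree_sum_def by (rule sum.remove[OF finite_subtree self_in_subtree])

lemma depth_subtree:
  assumes "i \<in> subtree j" "i \<noteq> j" shows "depth j < depth i"
  using assms
proof (induction "depth i" arbitrary: i rule: less_induct)
  case less
  have i: "i \<in> V0" using less.prems(1) subtree_subset by blast
  from subtree_step[OF i, of j] less.prems consider "par i \<in> subtree j" | "par i = s" "j = s" by blast
  then show ?case
  proof cases
    case 1
    then show ?thesis
      using less.hyps[of "par i"] depth_parent[OF i] by (cases "par i = j") auto
  qed (use depth_parent[OF i] in simp)
qed

lemma phi_inj_on_box: "inj_on (phi T s) box"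
proof (rule inj_onI)
  fix u w assume u: "u \<in> box" and w: "w \<in> box" and eq: "phi T s u = phi T s w"
  have bound: "depth j \<le> card V" if "j \<in> V0" for j
    using that depth_le_card by (simp add: V0_iff)
  have "u j = w j" if "j \<in> V0" for j
    using that
  \<comment> \<open>Deeper vertices come first; the bound on depths keeps the truncated measure
    strictly monotone.\<close>
  proof (induction "card V - depth j" arbitrary: j rule: less_induct)
    case less
    have "u i = w i" if i: "i \<in> subtree j - {j}" for i
    proof -
      have "i \<in> V0" using i subtree_subset by blast
      with less.hyps[of i] depth_subtree[of i j] bound[of i] i show ?thesis by force
    qed
    then have "(\<Sum>i\<in>subtree j - {j}. int (u i)) = (\<Sum>i\<in>subtree j - {j}. int (w i))"
      by (intro sum.cong) auto
    moreover have "subtree_sum u j mod int (e j) = subtree_sum w j mod int (e j)"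
      using fun_cong[OF eq, of j] less.prems by (simp add: phi_eq)
    ultimately have "[int (u j) = int (w j)] (mod int (e j))"
      using subtree_sum_split[OF less.prems] by (simp add: cong_def mod_eq_dvd_iff)
    moreover have "int (u j) \<in> {int (d j) - int (e j)..<int (d j)}"
      "int (w j) \<in> {int (d j) - int (e j)..<int (d j)}"
      using u w less.prems deg_ge_parent_mult by (auto simp: box_def)
    ultimately have "int (u j) = int (w j)" using cong_window_unique by blast
    then show ?case by simp
  qed
  moreover have "u \<in> V0 \<rightarrow>\<^sub>E UNIV" "w \<in> V0 \<rightarrow>\<^sub>E UNIV" using u w by (auto simp: box_def configs_def)
  ultimately show "u = w" by (intro PiE_ext)
qed

lemma plus_config_in_box:
  assumes "\<And>i. i \<in> V0 \<Longrightarrow> d i \<le> u i"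
  shows "stab (plus_config u v) \<in> box"
proof (rule stab_large_in_box)
  show "d i \<le> plus_config u v i" if "i \<in> V0" for i
    using assms[OF that] that by (simp add: plus_config_def)
qed simp

lemma recurrent_iff: "recurrent T s u \<longleftrightarrow> u \<in> box"
proof
  assume "recurrent T s u"
  \<comment> \<open>Recurrence is tested against the configuration in which every vertex is only
    just unstable.\<close>
  moreover have "(\<lambda>i\<in>V0. d i) \<in> configs T s" by (simp add: configs_def)
  ultimately obtain w where "stab (plus_config (\<lambda>i\<in>V0. d i) w) = u"
    unfolding recurrent_def sandpile_add_eq by blast
  then show "u \<in> box"
    using plus_config_in_box[of "\<lambda>i\<in>V0. d i" w] by (auto simp: configs_def)
next
  assume u: "u \<in> box"
  have "\<exists>w\<in>configs T s. sandpile_add T s v w = u" for v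
  proof -
    define L where "L = (\<Prod>j\<in>V0. e j)"
    have L: "e j dvd L" if "j \<in> V0" for j using that by (simp add: L_def dvd_prodI)
    have "L > 0" unfolding L_def using parent_mult_pos by (simp add: prod_pos)
    \<comment> \<open>Chosen so that \<open>v + w\<close> is \<open>u + L * (v + d)\<close>:
      congruent to \<open>u\<close> modulo every \<open>e j\<close>, and unstable everywhere because
      \<open>L\<close> is positive.\<close>
    define w where "w = (\<lambda>i\<in>V0. u i + (L - 1) * v i + L * d i)"
    have vw: "plus_config v w = (\<lambda>i\<in>V0. u i + L * (v i + d i))"
      using \<open>L > 0\<close> by (cases L) (auto simp: plus_config_def w_def fun_eq_iff algebra_simps)
    have "stab (plus_config v w) \<in> box"
      using \<open>L > 0\<close> unfolding vw by (intro stab_large_in_box) (cases L; auto simp: configs_def)+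
    moreover have "phi T s (stab (plus_config v w)) = phi T s u"
      unfolding phi_stab unfolding phi_eq
    proof (rule restrict_ext)
      fix j assume j: "j \<in> V0"
      have "subtree_sum (plus_config v w) j = (\<Sum>i\<in>subtree j. int (u i) + int L * int (v i + d i))"
        unfolding subtree_sum_def vw using subtree_subset[of j] by (intro sum.cong) auto
      also have "\<dots> = subtree_sum u j + int L * (\<Sum>i\<in>subtree j. int (v i + d i))"
        unfolding sum.distrib sum_distrib_left[symmetric] subtree_sum_def ..
      finally show "subtree_sum (plus_config v w) j mod int (e j) = subtree_sum u j mod int (e j)"
        using L[OF j] by (simp add: mod_eq_dvd_iff)
    qed
    ultimately have "sandpile_add T s v w = u"
      unfolding sandpile_add_eq using phi_inj_on_box u by (simp add: inj_on_eq_iff)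
    moreover have "w \<in> configs T s" by (simp add: w_def configs_def)
    ultimately show ?thesis by blast
  qed
  then show "recurrent T s u" using u by (auto simp: recurrent_def box_def)
qed

lemma carrier_sandpile_group: "carrier (sandpile_group T s) = box"
  by (auto simp: sandpile_group_def recurrent_iff)

text \<open>By recurrence \<open>u\<close> is the stabilization of a sum with every vertex unstable.
  Adding \<open>v\<close> before that stabilization gives the same result and keeps every vertex
  unstable.\<close>

lemma sandpile_add_in_box:
  assumes "u \<in> box" shows "sandpile_add T s u v \<in> box"
proof -
  have "(\<lambda>i\<in>V0. d i) \<in> configs T s" by (simp add: configs_def)
  then obtain w where "stab (plus_config (\<lambda>i\<in>V0. d i) w) = u"
    using assms unfolding recurrent_iff[symmetric] recurrent_def sandpile_add_eq by blast
  then have "stab (plus_config u v) = stab (plus_config (plus_config (\<lambda>i\<in>V0. d i) w) v)"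
    using stab_steps steps_plus_config steps_stab by metis
  also have "\<dots> \<in> box"
    by (intro plus_config_in_box) (auto simp: plus_config_def configs_def)
  finally show ?thesis by (simp add: sandpile_add_eq)
qed

section \<open>The sandpile group\<close>

lemma carrier_residue_product:
  "carrier (residue_product T s) = (\<Pi>\<^sub>E j\<in>V0. {0..<int (e j)})"
  unfolding residue_product_def carrier_product_group carrier_integer_mod_group
  \<comment> \<open>Positive moduli select the finite case, \<open>integer_mod_group 0\<close> being
    the integers.\<close>
  by (intro PiE_cong) (simp add: parent_mult_pos)

lemma phi_in_residues: "phi T s u \<in> carrier (residue_product T s)"
  using parent_mult_pos by (auto simp: carrier_residue_product phi_eq)

lemma card_box: "card box = card (carrier (residue_product T s))"
proof -
  have "box = (\<Pi>\<^sub>E j\<in>V0. {d j - e j..<d j})"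
    by (auto simp: box_def configs_def PiE_iff extensional_def)
  then show ?thesis
    using deg_ge_parent_mult by (simp add: carrier_residue_product card_PiE)
qed

lemma bij_betw_phi: "bij_betw (phi T s) box (carrier (residue_product T s))"
proof -
  have fin: "finite (carrier (residue_product T s))"
    by (simp add: carrier_residue_product finite_PiE)
  have "phi T s ` box = carrier (residue_product T s)"
    using phi_inj_on_box phi_in_residues fin card_box
    by (intro card_subset_eq) (auto simp: card_image)
  then show ?thesis using phi_inj_on_box by (simp add: bij_betw_def)
qed

lemma comm_group_residue_product: "comm_group (residue_product T s)"
  unfolding residue_product_def
  by (intro group.group_comm_groupI) (auto simp: add.commute fun_eq_iff)

lemma phi_mult:
  "phi T s (u \<otimes>\<^bsub>sandpile_group T s\<^esub> v) = phi T s u \<otimes>\<^bsub>residue_product T s\<^esub> phi T s v"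
  by (simp add: sandpile_group_def residue_product_def phi_add)

lemma phi_iso: "phi T s \<in> iso (sandpile_group T s) (residue_product T s)"
  using bij_betw_phi phi_in_residues
  by (auto simp: iso_def hom_def phi_mult carrier_sandpile_group)

text \<open>A preimage of the neutral residue vector is neutral because \<open>phi\<close> is
  injective on \<open>box\<close>. Any other candidate has an idempotent image, so it coincides with
  this one.\<close>

lemma
  shows one_in_box: "\<one>\<^bsub>sandpile_group T s\<^esub> \<in> box" and
    phi_one: "phi T s \<one>\<^bsub>sandpile_group T s\<^esub> = \<one>\<^bsub>residue_product T s\<^esub>"
proof -
  interpret R: comm_group "residue_product T s" by (rule comm_group_residue_product)
  let ?P = "\<lambda>z. recurrent T s z \<and> (\<forall>u. recurrent T s u \<longrightarrow> sandpile_add T s z u = u)"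
  have mult: "phi T s (sandpile_add T s u v) = phi T s u \<otimes>\<^bsub>residue_product T s\<^esub> phi T s v" for u v
    using phi_mult by (simp add: sandpile_group_def)
  obtain z where z: "z \<in> box" "phi T s z = \<one>\<^bsub>residue_product T s\<^esub>"
    using bij_betw_phi R.one_closed by (metis bij_betw_iff_bijections)
  have "sandpile_add T s z u = u" if "u \<in> box" for u
    using phi_inj_on_box sandpile_add_in_box[OF z(1)] that
    by (metis inj_onD mult z(2) R.l_one phi_in_residues)
  with z have "?P z" by (simp add: recurrent_iff)
  moreover have "z' = z" if "?P z'" for z'
  proof -
    have "phi T s z' \<otimes>\<^bsub>residue_product T s\<^esub> phi T s z' = phi T s z'"
      using that mult by metis
    then have "phi T s z' = phi T s z"
      using z phi_in_residues R.l_cancel_one by metis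
    then show ?thesis
      by (rule inj_onD[OF phi_inj_on_box]) (use that z(1) in \<open>simp_all add: recurrent_iff\<close>)
  qed
  ultimately have "\<one>\<^bsub>sandpile_group T s\<^esub> = z"
    unfolding sandpile_group_def monoid.simps by (rule the_equality)
  with z show "\<one>\<^bsub>sandpile_group T s\<^esub> \<in> box"
    "phi T s \<one>\<^bsub>sandpile_group T s\<^esub> = \<one>\<^bsub>residue_product T s\<^esub>" by simp_all
qed

text \<open>Every law is pulled back along \<open>phi\<close>, which is multiplicative and injective
  on \<open>box\<close>.\<close>

lemma comm_group_sandpile: "comm_group (sandpile_group T s)"
proof -
  interpret R: comm_group "residue_product T s" by (rule comm_group_residue_product)
  have closed: "u \<otimes>\<^bsub>sandpile_group T s\<^esub> v \<in> box" if "u \<in> box" for u v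
    using sandpile_add_in_box[OF that] by (simp add: sandpile_group_def)
  have eqI: "u = v" if "phi T s u = phi T s v" "u \<in> box" "v \<in> box" for u v
    using that phi_inj_on_box by (simp add: inj_on_eq_iff)
  show ?thesis
  proof (rule comm_groupI; unfold carrier_sandpile_group)
    fix u v w assume "u \<in> box" "v \<in> box" "w \<in> box"
    then show "u \<otimes>\<^bsub>sandpile_group T s\<^esub> v \<otimes>\<^bsub>sandpile_group T s\<^esub> w =
        u \<otimes>\<^bsub>sandpile_group T s\<^esub> (v \<otimes>\<^bsub>sandpile_group T s\<^esub> w)"
      by (intro eqI) (simp_all add: phi_mult R.m_assoc phi_in_residues closed)
  next
    fix u v assume "u \<in> box" "v \<in> box"
    then show "u \<otimes>\<^bsub>sandpile_group T s\<^esub> v = v \<otimes>\<^bsub>sandpile_group T s\<^esub> u"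
      by (intro eqI) (simp_all add: phi_mult R.m_comm phi_in_residues closed)
  next
    fix u assume "u \<in> box"
    then show "\<one>\<^bsub>sandpile_group T s\<^esub> \<otimes>\<^bsub>sandpile_group T s\<^esub> u = u"
      by (intro eqI) (simp_all add: phi_mult phi_one one_in_box phi_in_residues closed)
  next
    fix u assume "u \<in> box"
    obtain v where v: "v \<in> box" "phi T s v = inv\<^bsub>residue_product T s\<^esub> phi T s u"
      using bij_betw_phi R.inv_closed[OF phi_in_residues[of u]] by (metis bij_betw_iff_bijections)
    then have "v \<otimes>\<^bsub>sandpile_group T s\<^esub> u = \<one>\<^bsub>sandpile_group T s\<^esub>"
      by (intro eqI) (simp_all add: phi_mult phi_one one_in_box phi_in_residues closed)
    with v show "\<exists>v\<in>box. v \<otimes>\<^bsub>sandpile_group T s\<^esub> u = \<one>\<^bsub>sandpile_group T s\<^esub>" by blast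
  qed (auto simp: closed one_in_box)
qed

section \<open>Independence of the sink\<close>

lemma bij_betw_thick_edges: "bij_betw (\<lambda>j. {j, par j}) V0 (thick_edges T)"
proof (rule bij_betw_imageI)
  show "inj_on (\<lambda>j. {j, par j}) V0"
  proof (rule inj_onI)
    fix j k assume jk: "j \<in> V0" "k \<in> V0" "{j, par j} = {k, par k}"
    then have "j = k \<or> (j = par k \<and> k = par j)" by (auto simp: doubleton_eq_iff)
    \<comment> \<open>In the swapped case each vertex would be deeper than the other.\<close>
    with depth_parent[OF jk(1)] depth_parent[OF jk(2)] show "j = k" by auto
  qed
  show "(\<lambda>j. {j, par j}) ` V0 = thick_edges T"
  proof
    show "(\<lambda>j. {j, par j}) ` V0 \<subseteq> thick_edges T"
      using adj_parent by (auto simp: thick_edges_def)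
    show "thick_edges T \<subseteq> (\<lambda>j. {j, par j}) ` V0"
      by (auto simp: thick_edges_def insert_commute elim!: adj_cases)
  qed
qed

text \<open>The left-hand side mentions no sink: each non-sink vertex corresponds to the edge
  towards its parent, whose multiplicity is the modulus.\<close>

lemma residue_product_iso:
  "product_group (thick_edges T) (\<lambda>E. integer_mod_group (card {x \<in> edges T. ends T x = E}))
    \<cong> residue_product T s"
  using product_group_reindex[OF bij_betw_thick_edges]
  unfolding residue_product_def parent_mult_def mult_edge_def .

section \<open>The recursion for the inverse\<close>

lemma phi_inv:
  assumes "v \<in> carrier (residue_product T s)"
  shows phi_inv_in_box: "phi_inv T s v \<in> box" and phi_phi_inv: "phi T s (phi_inv T s v) = v"
  using assms bij_betw_phi
  by (auto simp: phi_inv_def carrier_sandpile_group bij_betw_def inv_into_into f_inv_into_f)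

lemma strict_subtree: "{i \<in> V0. succ_strict T s i j} = subtree j - {j}"
  by (auto simp: subtree_def succ_strict_def)

lemma window_rep_eqI:
  assumes "j \<in> V0" "u \<in> box" "[int (u j) = x] (mod int (e j))"
  shows "window_rep T s j x = int (u j)"
proof -
  have r: "int (u j) \<in> {int (d j) - int (e j)..<int (d j)}"
    using assms deg_ge_parent_mult by (auto simp: box_def)
  show ?thesis
    unfolding window_rep_def
  proof (rule the_equality)
    fix y assume "y \<in> {int (d j) - int (e j)..int (d j) - 1} \<and> [y = x] (mod int (e j))"
    then show "y = int (u j)"
      using assms(3) r by (intro cong_window_unique[of _ _ "int (e j)" "int (d j)"])
        (auto simp: cong_def)
  qed (use r assms(3) in auto)
qed

lemma ex_child:
  assumes "i \<in> subtree j" "i \<noteq> j" "j \<in> V0" shows "\<exists>c\<in>V0. par c = j"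
  using assms(1,2)
proof (induction "depth i" arbitrary: i rule: less_induct)
  case less
  have i: "i \<in> V0" using less.prems(1) subtree_subset by blast
  with less.prems assms(3) have "par i \<in> subtree j"
    using subtree_step[OF i] by (auto simp: V0_iff)
  with less.hyps[of "par i"] depth_parent[OF i] i show ?case by (cases "par i = j") auto
qed

text \<open>A child would be a second neighbour besides the parent, and without loops every edge at
  \<open>j\<close> leads to the parent.\<close>

lemma loopless_leaf:
  assumes "leaf T s j" "m j j = 0"
  shows "subtree j = {j}" "d j = e j"
proof -
  have j: "j \<in> V0" and card: "card {k. simple_adj T j k} = 1" using assms by (auto simp: leaf_def)
  from card obtain x where x: "{k. simple_adj T j k} = {x}" by (rule card_1_singletonE)
  then have "k = x" if "simple_adj T j k" for k using that by blast
  with adj_parent[OF j] have adj: "k = par j" if "simple_adj T j k" for k using that by metis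
  have "(\<Sum>k\<in>{par j}. m j k) = d j"
  proof (rule deg_subset_sum)
    fix k assume "k \<in> V - {par j}"
    then have "k \<in> V" "\<not> simple_adj T j k" using adj[of k] by auto
    then show "m j k = 0" using assms(2) j by (auto simp: simple_adj_def V0_iff)
  qed (use j parent_in_V in \<open>auto simp: V0_iff\<close>)
  then show "d j = e j" by (simp add: parent_mult_def)
  have False if c: "c \<in> V0" "par c = j" for c
  proof -
    have "simple_adj T j c" using adj_parent[OF c(1)] c(2) by (simp add: simple_adj_commute)
    then have "c = par j" by (rule adj)
    then show False using depth_parent[OF j] depth_parent[OF c(1)] c by simp
  qed
  then show "subtree j = {j}" using ex_child j self_in_subtree by blast
qed

text \<open>This is \<open>phi T s (phi_inv T s v) = v\<close> at \<open>j\<close>, solved for the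
  entry of \<open>j\<close>. At a loopless leaf the remaining sum is empty and the entry is below
  \<open>e j\<close>; elsewhere the window recovers the entry from its residue.\<close>

lemma phi_inv_recursion:
  assumes v: "v \<in> carrier (residue_product T s)" and j: "j \<in> V0"
  shows "int (phi_inv T s v j) =
    (if leaf T s j \<and> m j j = 0 then v j
     else window_rep T s j (v j - (\<Sum>i | i \<in> V0 \<and> succ_strict T s i j. int (phi_inv T s v i))))"
proof -
  let ?u = "phi_inv T s v"
  let ?R = "\<Sum>i | i \<in> V0 \<and> succ_strict T s i j. int (?u i)"
  have vj: "v j = (int (?u j) + ?R) mod int (e j)"
    using fun_cong[OF phi_phi_inv[OF v], of j] j
    by (simp add: phi_eq subtree_sum_split strict_subtree)
  show ?thesis
  proof (cases "leaf T s j \<and> m j j = 0")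
    case True
    then have "?R = 0" and "?u j < e j"
      using loopless_leaf[of j] phi_inv_in_box[OF v] j by (auto simp: strict_subtree box_def)
    with vj True show ?thesis by simp
  next
    case False
    have "[int (?u j) = v j - ?R] (mod int (e j))"
      by (simp add: vj cong_def mod_diff_left_eq)
    from window_rep_eqI[OF j phi_inv_in_box[OF v] this] show ?thesis
      by (simp only: if_not_P[OF False])
  qed
qed

end

text \<open>Both groups are compared with the product over \<open>thick_edges T\<close>.\<close>

lemma sandpile_group_iso_sinks:
  assumes "thick_tree T" "s \<in> verts T" "s' \<in> verts T"
  shows "sandpile_group T s \<cong> sandpile_group T s'"
proof -
  let ?P = "product_group (thick_edges T) (\<lambda>E. integer_mod_group (card {x \<in> edges T. ends T x = E}))"
  interpret A: rooted_thick_tree T s by unfold_locales (use assms in auto)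
  interpret B: rooted_thick_tree T s' by unfold_locales (use assms in auto)
  have "sandpile_group T s \<cong> residue_product T s" using A.phi_iso by (auto simp: is_iso_def)
  also have "residue_product T s \<cong> ?P"
    by (rule group.iso_sym[OF _ A.residue_product_iso]) simp
  also have "?P \<cong> residue_product T s'" by (rule B.residue_product_iso)
  also have "residue_product T s' \<cong> sandpile_group T s'"
    using group.iso_sym[OF comm_group.axioms(2)[OF B.comm_group_sandpile]] B.phi_iso
    by (auto simp: is_iso_def)
  finally show ?thesis .
qed

text \<open>The entry is \<open>v j\<close> itself only at leaves without loops: at a leaf with
  loops it is at least the number of loops, hence never the representative 0.\<close>

theorem theorem3p4:
  fixes T :: "('a, 'b) multigraph" and s :: 'a
  assumes "thick_tree T" and "s \<in> verts T"
  shows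
    "carrier (sandpile_group T s) =
       {u \<in> configs T s. \<forall>j\<in>nonsink T s.
          deg T j > u j \<and> u j \<ge> deg T j - parent_mult T s j}
     \<and> comm_group (sandpile_group T s)
     \<and> phi T s \<in> iso (sandpile_group T s) (residue_product T s)
     \<and> (\<forall>s'\<in>verts T. sandpile_group T s \<cong> sandpile_group T s')
     \<and> (\<forall>v\<in>carrier (residue_product T s). \<forall>j\<in>nonsink T s.
          int (phi_inv T s v j) =
            (if leaf T s j \<and> mult_edge T j j = 0 then v j
             else window_rep T s j
               (v j - (\<Sum>i | i \<in> nonsink T s \<and> succ_strict T s i j. int (phi_inv T s v i)))))"
proof -
  interpret rooted_thick_tree T s by unfold_locales (use assms in auto)
  show ?thesis
    using carrier_sandpile_group comm_group_sandpile phi_iso phi_inv_recursion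
      sandpile_group_iso_sinks[OF assms]
    by (simp add: box_def)
qed

end
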